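(* Fix an integer $q \ge 2$, and let $t = t(n)$ be any function taking positive integer values with $t(n) \le 10\sqrt{n}$ for all $n$. Then the number of $q$-ary $t$-error correcting codes of length $n$ is at most $2^{(1+o(1)) H_q(n,t)}$, where $o(1)$ denotes a quantity tending to $0$ as $n \to \infty$.
   Context: For integers $q\ge 2$, $n \ge 1$, $t \ge 0$: a $q$-ary $t$-error correcting code of length $n$ is a subset of $[q]^n=\{1,\dots,q\}^n$ whose elements pairwise differ in at least $2t+1$ coordinates (the empty set and singletons count as codes). The Hamming distance $d(x,y)$ between $x,y\in[q]^n$ is the number of coordinates in which they differ. $V_q(n,r) = \sum_{i=0}^{r}\binom{n}{i}(q-1)^i$ is the cardinality of a Hamming ball of radius $r$ in $[q]^n$, and $H_q(n,t) = q^n / V_q(n,t)$ (the Hamming bound). *)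

theory Defs
  imports Complex_Main
begin

definition words :: "nat \<Rightarrow> nat \<Rightarrow> nat list set" where
  "words q n = {xs. length xs = n \<and> set xs \<subseteq> {1..q}}"

definition hamming_dist :: "nat list \<Rightarrow> nat list \<Rightarrow> nat" where
  "hamming_dist xs ys = card {i. i < length xs \<and> xs ! i \<noteq> ys ! i}"

definition is_code :: "nat \<Rightarrow> nat \<Rightarrow> nat \<Rightarrow> nat list set \<Rightarrow> bool" where
  "is_code q n t C \<longleftrightarrow> C \<subseteq> words q n \<and>
     (\<forall>x\<in>C. \<forall>y\<in>C. x \<noteq> y \<longrightarrow> hamming_dist x y \<ge> 2 * t + 1)"

definition hamming_ball_vol :: "nat \<Rightarrow> nat \<Rightarrow> nat \<Rightarrow> nat" where
  "hamming_ball_vol q n r = (\<Sum>i=0..r. (n choose i) * (q - 1) ^ i)"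

definition hamming_bound :: "nat \<Rightarrow> nat \<Rightarrow> nat \<Rightarrow> real" where
  "hamming_bound q n t = real (q ^ n) / real (hamming_ball_vol q n t)"

end

theory Submission
  imports Defs "HOL-Library.FuncSet" "HOL-Real_Asymp.Real_Asymp"
begin

text \<open>
  Codes are the independent sets of the graph on words in which two words are joined when their
  distance is at most \<open>2 * t\<close>. Splitting on whether a vertex \<open>v\<close> of high degree is used gives
  \<open>i(U) \<le> i(U - v) + i(U - N[v])\<close>, and iterating this (Kleitman--Winston) bounds \<open>i(U)\<close> by the number
  of small fingerprints times the largest \<open>i(W)\<close> over sets \<open>W\<close> too small to force high degrees.

  High degrees come from double counting the pairs of codewords in a common radius \<open>t\<close> ball: by
  Cauchy--Schwarz a set of \<open>\<lambda> H\<close> words has an element \<open>x\<close> whose ball has total overlap at least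
  \<open>(\<lambda> - 1) V\<close> with the other balls, while two balls at distance at least \<open>2 k - 1\<close> overlap in
  \<open>O((t / n) ^ k V)\<close> words. The fingerprints are chosen in two stages. From \<open>q ^ n\<close> down to
  \<open>(n q) ^ 6 H\<close> words, the pairs at distance at most 4 are negligible and \<open>k = 3\<close> applies, which makes
  up for the large entropy \<open>t log n\<close> per fingerprint element. From there down to \<open>(1 + \<delta>) H\<close>, the
  entropy per element is only \<open>O(log n)\<close> and \<open>k = 1\<close> suffices. Taking \<open>\<delta> = n powr (- 1 / 4)\<close> makes
  both costs \<open>o(H)\<close>.
\<close>

section \<open>Independent sets and the container bound\<close>

definition indep_sets :: "('a \<Rightarrow> 'a \<Rightarrow> bool) \<Rightarrow> 'a set \<Rightarrow> 'a set set" where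
  "indep_sets E U = {I. I \<subseteq> U \<and> (\<forall>x\<in>I. \<forall>y\<in>I. x \<noteq> y \<longrightarrow> \<not> E x y)}"

lemma finite_indep_sets: "finite U \<Longrightarrow> finite (indep_sets E U)"
  by (rule finite_subset[of _ "Pow U"]) (auto simp: indep_sets_def)

lemma card_indep_sets_le: "finite U \<Longrightarrow> card (indep_sets E U) \<le> 2 ^ card U"
  using card_mono[of "Pow U" "indep_sets E U"] by (auto simp: indep_sets_def card_Pow)

lemma card_indep_sets_recursion:
  assumes "finite U" "v \<in> U"
  shows "card (indep_sets E U) \<le>
    card (indep_sets E (U - {v})) + card (indep_sets E (U - {v} - {y \<in> U. E v y}))"
proof -
  let ?N = "U - {v} - {y \<in> U. E v y}"
  have "indep_sets E U \<subseteq> indep_sets E (U - {v}) \<union> insert v ` indep_sets E ?N"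
  proof
    fix I assume I: "I \<in> indep_sets E U"
    show "I \<in> indep_sets E (U - {v}) \<union> insert v ` indep_sets E ?N"
    proof (cases "v \<in> I")
      case True
      then have "I = insert v (I - {v})" by auto
      moreover have "I - {v} \<in> indep_sets E ?N"
        using I True by (auto simp: indep_sets_def)
      ultimately show ?thesis by blast
    next
      case False
      then show ?thesis using I by (auto simp: indep_sets_def)
    qed
  qed
  then have "card (indep_sets E U) \<le> card (indep_sets E (U - {v}) \<union> insert v ` indep_sets E ?N)"
    using assms by (intro card_mono) (auto intro: finite_indep_sets)
  also have "\<dots> \<le> card (indep_sets E (U - {v})) + card (insert v ` indep_sets E ?N)"
    by (rule card_Un_le)
  also have "card (insert v ` indep_sets E ?N) \<le> card (indep_sets E ?N)"
    using assms by (intro card_image_le finite_indep_sets) auto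
  finally show ?thesis by simp
qed

text \<open>
  The induction is Pascal's rule for \<open>\<Sum>j\<le>l. card U choose j\<close>, stated for the upper bound
  \<open>(1 + x) ^ card U / x ^ l\<close> of that sum.
\<close>

lemma card_indep_sets_container:
  fixes x \<beta> R M :: real
  assumes "finite U" and x: "0 < x" "x \<le> 1" and M: "M \<ge> 0"
    and "\<And>W. W \<subseteq> U \<Longrightarrow> card W > R \<Longrightarrow>
           \<exists>v\<in>W. \<beta> * card W \<le> card {y \<in> W. y \<noteq> v \<and> E v y}"
    and "\<And>W. W \<subseteq> U \<Longrightarrow> card W \<le> R \<Longrightarrow> card (indep_sets E W) \<le> M"
    and "card U * exp (- \<beta> * real l) \<le> R"
  shows "card (indep_sets E U) \<le> M * (1 + x) ^ card U * (1 / x) ^ l"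
  using assms(1,5-)
proof (induction U arbitrary: l rule: finite_psubset_induct)
  case (psubset U)
  note deg = psubset.prems(1) and base = psubset.prems(2) and size = psubset.prems(3)
  have inv_ge: "1 / x \<ge> 1" using x by simp
  show ?case
  proof (cases "card U \<le> R")
    case True
    then have "card (indep_sets E U) \<le> M" by (intro base) auto
    also have "M * 1 * 1 \<le> M * (1 + x) ^ card U * (1 / x) ^ l"
      using x inv_ge M by (intro mult_mono one_le_power) auto
    finally show ?thesis by simp
  next
    case False
    then obtain v where v: "v \<in> U" and dv: "\<beta> * card U \<le> card {y \<in> U. y \<noteq> v \<and> E v y}"
      using deg[of U] by auto
    \<comment> \<open>For \<open>l = 0\<close> the assumption \<open>size\<close> would read
      \<open>card U \<le> R\<close>.\<close>
    have "l \<noteq> 0" using size False by (intro notI) simp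
    then obtain k where k: "l = Suc k" by (cases l) auto
    \<comment> \<open>Using \<open>v\<close> shrinks the set by a factor
      \<open>exp (- \<beta>)\<close>, which pays for one of the \<open>l\<close> steps; discarding
      \<open>v\<close> keeps \<open>l\<close> unchanged.\<close>
    let ?N = "U - {v} - {y \<in> U. E v y}"
    have eqN: "?N = (U - {v}) - {y \<in> U. y \<noteq> v \<and> E v y}" by auto
    have cU: "card (U - {v}) = card U - 1" "card U \<ge> 1"
      using v psubset.hyps by (auto simp: card_Diff_singleton Suc_le_eq card_gt_0_iff)
    have "card {y \<in> U. y \<noteq> v \<and> E v y} \<le> card (U - {v})"
      using psubset.hyps by (intro card_mono) auto
    moreover have "card ?N = card (U - {v}) - card {y \<in> U. y \<noteq> v \<and> E v y}"
      unfolding eqN using psubset.hyps by (intro card_Diff_subset) auto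
    ultimately have "real (card ?N) \<le> (1 - \<beta>) * card U"
      using dv cU by (simp add: of_nat_diff algebra_simps)
    also have "1 - \<beta> \<le> exp (- \<beta>)" using exp_ge_add_one_self[of "- \<beta>"] by simp
    finally have cN: "real (card ?N) \<le> exp (- \<beta>) * card U" by (simp add: mult_right_mono)
    have "real (card ?N) * exp (- \<beta> * k) \<le> exp (- \<beta>) * card U * exp (- \<beta> * k)"
      using cN by (intro mult_right_mono) auto
    also have "\<dots> = card U * exp (- \<beta> * l)"
      by (simp add: k algebra_simps flip: exp_add)
    finally have szN: "real (card ?N) * exp (- \<beta> * k) \<le> R" using size by simp
    have szU: "real (card (U - {v})) * exp (- \<beta> * l) \<le> R"
      by (rule order_trans[OF mult_right_mono size]) (auto simp: cU)
    have IH1: "card (indep_sets E (U - {v})) \<le> M * (1 + x) ^ card (U - {v}) * (1 / x) ^ l"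
      by (rule psubset.IH[OF _ _ _ szU]) (use v in \<open>auto intro!: deg base\<close>)
    have "card (indep_sets E ?N) \<le> M * (1 + x) ^ card ?N * (1 / x) ^ k"
      by (rule psubset.IH[OF _ _ _ szN]) (use v in \<open>auto intro!: deg base\<close>)
    also have "\<dots> \<le> M * (1 + x) ^ card (U - {v}) * (1 / x) ^ k"
      using x M psubset.hyps
      by (intro mult_right_mono mult_left_mono power_increasing card_mono) auto
    finally have IH2: "card (indep_sets E ?N) \<le> M * (1 + x) ^ card (U - {v}) * (1 / x) ^ k" .
    have "real (card (indep_sets E U)) \<le>
        M * (1 + x) ^ card (U - {v}) * (1 / x) ^ l + M * (1 + x) ^ card (U - {v}) * (1 / x) ^ k"
      using card_indep_sets_recursion[OF psubset.hyps(1) v, of E] IH1 IH2 by linarith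
    \<comment> \<open>Since \<open>(1 / x) ^ k = x * (1 / x) ^ l\<close>, the second summand is
      \<open>x\<close> times the first.\<close>
    also have "\<dots> = M * ((1 + x) ^ card (U - {v}) * (1 + x)) * (1 / x) ^ l"
      using x by (simp add: k field_simps)
    also have "(1 + x) ^ card (U - {v}) * (1 + x) = (1 + x) ^ card U"
      using cU by (simp flip: power_Suc2)
    finally show ?thesis .
  qed
qed

text \<open>Here \<open>x = 1 / y\<close> and \<open>l\<close> is the ceiling of \<open>L\<close>;
  the rounding turns \<open>L\<close> into \<open>L + 1\<close>. In both applications
  \<open>y\<close> is \<open>n\<close> times the ratio of \<open>K\<close> to the Hamming bound
  \<open>H\<close>, so that \<open>K / y\<close> becomes the negligible
  \<open>H / n\<close>.\<close>

lemma card_indep_sets_container_exp: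
  fixes y \<beta> R M K L :: real
  assumes "finite U" and y: "y \<ge> 1" and M: "M \<ge> 0" and \<beta>: "\<beta> > 0" and L: "L \<ge> 0"
    and K: "card U \<le> K" "K * exp (- \<beta> * L) \<le> R"
    and "\<And>W. W \<subseteq> U \<Longrightarrow> card W > R \<Longrightarrow>
           \<exists>v\<in>W. \<beta> * card W \<le> card {y \<in> W. y \<noteq> v \<and> E v y}"
    and "\<And>W. W \<subseteq> U \<Longrightarrow> card W \<le> R \<Longrightarrow> card (indep_sets E W) \<le> M"
  shows "card (indep_sets E U) \<le> M * exp (K / y + (L + 1) * ln y)"
proof -
  define l where "l = nat \<lceil>L\<rceil>"
  have l: "L \<le> l" "l \<le> L + 1" using L by (auto simp: l_def)
  have "card U * exp (- \<beta> * l) \<le> K * exp (- \<beta> * L)"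
    using K l \<beta> by (intro mult_mono) auto
  then have "card (indep_sets E U) \<le> M * (1 + 1 / y) ^ card U * (1 / (1 / y)) ^ l"
    using y K by (intro card_indep_sets_container[where \<beta> = \<beta> and R = R] assms) auto
  also have "\<dots> = M * ((1 + 1 / y) ^ card U * y ^ l)" by simp
  also have "\<dots> \<le> M * (exp (K / y) * exp ((L + 1) * ln y))"
  proof (intro mult_left_mono mult_mono M)
    have "(1 + 1 / y) ^ card U \<le> exp (1 / y) ^ card U"
      using y exp_ge_add_one_self[of "1 / y"] by (intro power_mono) auto
    also have "\<dots> = exp (card U / y)" by (simp flip: exp_of_nat_mult)
    also have "\<dots> \<le> exp (K / y)" using K y by (simp add: divide_right_mono)
    finally show "(1 + 1 / y) ^ card U \<le> exp (K / y)" .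
    have "y ^ l = exp (l * ln y)" using y by (simp add: exp_of_nat_mult)
    also have "\<dots> \<le> exp ((L + 1) * ln y)" using l y by (simp add: mult_right_mono)
    finally show "y ^ l \<le> exp ((L + 1) * ln y)" .
  qed (use y in auto)
  finally show ?thesis by (simp add: exp_add)
qed

section \<open>Hamming balls counted through sets of differing coordinates\<close>

definition diff_coords :: "'a list \<Rightarrow> 'a list \<Rightarrow> nat set" where
  "diff_coords xs ys = {i. i < length xs \<and> xs ! i \<noteq> ys ! i}"

lemma hamming_dist_eq: "hamming_dist xs ys = card (diff_coords xs ys)"
  by (simp add: hamming_dist_def diff_coords_def)

lemma diff_coords_subset: "x \<in> words q n \<Longrightarrow> diff_coords x y \<subseteq> {..<n}"
  by (auto simp: diff_coords_def words_def)

lemma finite_diff_coords [simp]: "finite (diff_coords x y)"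
  by (simp add: diff_coords_def)

lemma card_words: "card (words q n) = q ^ n" and finite_words [simp]: "finite (words q n)"
  using card_lists_length_eq[of "{1..q}" n] finite_lists_length_eq[of "{1..q}" n]
  by (auto simp: words_def conj_commute)

text \<open>Outside \<open>S\<close> each letter must agree with \<open>x\<close>, and on
  \<open>S\<close> it is any of the \<open>q - 1\<close> other letters, so these words correspond to
  a product of sets.\<close>

lemma card_words_diff_coords_eq:
  assumes x: "x \<in> words q n" and S: "S \<subseteq> {..<n}"
  shows "card {z \<in> words q n. diff_coords x z = S} = (q - 1) ^ card S"
proof -
  let ?B = "\<lambda>i. if i \<in> S then {1..q} - {x ! i} else {x ! i}"
  have xi: "x ! i \<in> {1..q}" if "i < n" for i
    using x that nth_mem[of i x] unfolding words_def by blast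
  have "bij_betw (\<lambda>f. map f [0..<n]) (PiE {..<n} ?B) {z \<in> words q n. diff_coords x z = S}"
  proof (rule bij_betw_byWitness[where f' = "\<lambda>z. restrict (\<lambda>i. z ! i) {..<n}"])
    show "\<forall>f\<in>PiE {..<n} ?B. restrict (\<lambda>i. map f [0..<n] ! i) {..<n} = f"
      by (auto simp: PiE_def extensional_def restrict_def fun_eq_iff)
    show "\<forall>z\<in>{z \<in> words q n. diff_coords x z = S}. map (restrict (\<lambda>i. z ! i) {..<n}) [0..<n] = z"
      by (auto simp: words_def list_eq_iff_nth_eq)
    show "(\<lambda>f. map f [0..<n]) ` PiE {..<n} ?B \<subseteq> {z \<in> words q n. diff_coords x z = S}"
    proof safe
      fix f assume f: "f \<in> PiE {..<n} ?B"
      have fB: "f i \<in> ?B i" if "i < n" for i using f that by (auto simp: PiE_def Pi_def)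
      show "map f [0..<n] \<in> words q n"
        using fB xi S by (fastforce simp: words_def split: if_splits)
      have "i \<in> diff_coords x (map f [0..<n]) \<longleftrightarrow> i \<in> S" for i
        using fB[of i] S x by (auto simp: diff_coords_def words_def split: if_splits)
      then show "i \<in> S" if "i \<in> diff_coords x (map f [0..<n])" for i using that by blast
      show "i \<in> diff_coords x (map f [0..<n])" if "i \<in> S" for i
        using that \<open>i \<in> diff_coords x (map f [0..<n]) \<longleftrightarrow> i \<in> S\<close> by blast
    qed
    show "(\<lambda>z. restrict (\<lambda>i. z ! i) {..<n}) ` {z \<in> words q n. diff_coords x z = S} \<subseteq> PiE {..<n} ?B"
    proof safe
      fix z i assume z: "z \<in> words q n" and "S = diff_coords x z" and i: "i < n"
      moreover have "z ! i \<in> {1..q}" using z i nth_mem[of i z] unfolding words_def by blast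
      ultimately show "restrict (\<lambda>i. z ! i) {..<n} i
        \<in> (if i \<in> diff_coords x z then {1..q} - {x ! i} else {x ! i})"
        using x by (auto simp: diff_coords_def words_def)
    qed (auto split: if_splits)
  qed
  then have "card {z \<in> words q n. diff_coords x z = S} = card (PiE {..<n} ?B)"
    by (simp add: bij_betw_same_card)
  also have "\<dots> = (\<Prod>i<n. if i \<in> S then q - 1 else 1)"
    using xi by (subst card_PiE) (auto intro!: prod.cong simp: card_Diff_singleton)
  also have "\<dots> = (\<Prod>i\<in>S. q - 1)"
    using S by (subst prod.If_cases) (auto simp: Int_absorb1)
  finally show ?thesis by simp
qed

lemma card_supersets:
  assumes "finite X" "A \<subseteq> X" "card A \<le> i"
  shows "card {S. S \<subseteq> X \<and> A \<subseteq> S \<and> card S = i} = (card X - card A) choose (i - card A)"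
proof -
  have fA: "finite A" using assms finite_subset by blast
  have "bij_betw (\<lambda>T. T \<union> A) {T. T \<subseteq> X - A \<and> card T = i - card A}
          {S. S \<subseteq> X \<and> A \<subseteq> S \<and> card S = i}"
  proof (rule bij_betw_byWitness[where f' = "\<lambda>S. S - A"])
    show "(\<lambda>T. T \<union> A) ` {T. T \<subseteq> X - A \<and> card T = i - card A}
        \<subseteq> {S. S \<subseteq> X \<and> A \<subseteq> S \<and> card S = i}"
    proof safe
      fix T assume T: "T \<subseteq> X - A" "card T = i - card A"
      have "finite T" using T assms finite_subset by blast
      then show "card (T \<union> A) = i" using T fA assms by (subst card_Un_disjoint) auto
    qed (use assms in auto)
    show "(\<lambda>S. S - A) ` {S. S \<subseteq> X \<and> A \<subseteq> S \<and> card S = i}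
        \<subseteq> {T. T \<subseteq> X - A \<and> card T = i - card A}"
      using fA by (auto simp: card_Diff_subset)
  qed auto
  then have "card {S. S \<subseteq> X \<and> A \<subseteq> S \<and> card S = i} = card {T. T \<subseteq> X - A \<and> card T = i - card A}"
    by (simp add: bij_betw_same_card)
  also have "\<dots> = card (X - A) choose (i - card A)"
    using assms by (intro n_subsets) auto
  finally show ?thesis using assms fA by (simp add: card_Diff_subset)
qed

text \<open>The words are grouped by their difference set \<open>S\<close>, each contributing
  \<open>(q - 1) ^ card S\<close>. The factor \<open>n choose card A\<close> avoids division: the
  number of \<open>S\<close> of size \<open>i\<close> above \<open>A\<close>, times this factor,
  counts nested pairs of sets of sizes \<open>card A\<close> and \<open>i\<close>.\<close>

lemma card_ball_containing:
  assumes x: "x \<in> words q n" and A: "A \<subseteq> {..<n}"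
  shows "card {z \<in> words q n. A \<subseteq> diff_coords x z \<and> hamming_dist x z \<le> t} * (n choose card A)
       = (\<Sum>i=0..t. (n choose i) * (i choose card A) * (q - 1) ^ i)"
proof -
  let ?Z = "{z \<in> words q n. A \<subseteq> diff_coords x z \<and> hamming_dist x z \<le> t}"
  let ?F = "\<lambda>i. {S. S \<subseteq> {..<n} \<and> A \<subseteq> S \<and> card S = i}"
  let ?G = "{S. S \<subseteq> {..<n} \<and> A \<subseteq> S \<and> card S \<le> t}"
  have fG: "finite ?G" by (rule finite_subset[of _ "Pow {..<n}"]) auto
  have fF: "finite (?F i)" for i by (rule finite_subset[of _ "Pow {..<n}"]) auto
  have fA: "finite A" using A finite_subset by blast
  have cF: "card (?F i) * (n choose card A) = (n choose i) * (i choose card A)" for i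
  proof (cases "card A \<le> i \<and> i \<le> n")
    case True
    then show ?thesis
      using card_supersets[of "{..<n}" A i] A choose_mult[of "card A" i n] by (simp add: mult.commute)
  next
    \<comment> \<open>Out of range no \<open>S\<close> exists, and one of the two binomials on the
      right is zero.\<close>
    case False
    have "card A \<le> card S \<and> card S \<le> n" if "S \<subseteq> {..<n}" "A \<subseteq> S" for S
      using card_mono[OF _ that(1)] card_mono[OF finite_subset[OF that(1)] that(2)] by simp
    then have empty: "?F i = {}" using False by blast
    show ?thesis unfolding empty using False by (auto simp: not_le binomial_eq_0)
  qed
  have "?Z = (\<Union>S\<in>?G. {z \<in> words q n. diff_coords x z = S})"
    using diff_coords_subset[OF x] by (auto simp: hamming_dist_eq)
  then have "card ?Z = card (\<Union>S\<in>?G. {z \<in> words q n. diff_coords x z = S})" by simp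
  also have "\<dots> = (\<Sum>S\<in>?G. card {z \<in> words q n. diff_coords x z = S})"
    using fG by (intro card_UN_disjoint) auto
  also have "\<dots> = (\<Sum>S\<in>?G. (q - 1) ^ card S)"
    using x by (intro sum.cong card_words_diff_coords_eq) auto
  also have "\<dots> = (\<Sum>i=0..t. \<Sum>S\<in>{S \<in> ?G. card S = i}. (q - 1) ^ card S)"
    using fG by (intro sum.group[symmetric]) auto
  also have "\<dots> = (\<Sum>i=0..t. card (?F i) * (q - 1) ^ i)"
  proof (intro sum.cong refl)
    fix i assume "i \<in> {0..t}"
    then have "{S \<in> ?G. card S = i} = ?F i" by auto
    then show "(\<Sum>S\<in>{S \<in> ?G. card S = i}. (q - 1) ^ card S) = card (?F i) * (q - 1) ^ i"
      by simp
  qed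
  finally have eq: "card ?Z = (\<Sum>i=0..t. card (?F i) * (q - 1) ^ i)" .
  show ?thesis
    unfolding eq sum_distrib_right
    by (intro sum.cong refl, subst cF[symmetric]) (simp only: ac_simps)
qed

lemma card_ball:
  "x \<in> words q n \<Longrightarrow> card {z \<in> words q n. hamming_dist x z \<le> t} = hamming_ball_vol q n t"
  using card_ball_containing[of x q n "{}" t] by (simp add: hamming_ball_vol_def)

text \<open>Factor by factor this is \<open>(t - j) / (n - j) \<le> t / n\<close> for
  \<open>j < k\<close>, kept in the naturals by clearing denominators. It is the source of all
  powers of \<open>t / n\<close> below.\<close>

lemma binomial_ratio:
  fixes n t k :: nat
  assumes "t \<le> n"
  shows "(t choose k) * n ^ k \<le> (n choose k) * t ^ k"
proof (induction k)
  case (Suc k)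
  have "(t - k) * n \<le> (n - k) * t"
    using assms by (cases "k \<le> t") (auto simp: diff_mult_distrib algebra_simps intro: diff_le_mono2)
  with Suc.IH have "((t choose k) * n ^ k) * ((t - k) * n) \<le> ((n choose k) * t ^ k) * ((n - k) * t)"
    by (rule mult_le_mono)
  moreover have c: "Suc k * (m choose Suc k) = (m choose k) * (m - k)" for m
    by (simp only: binomial_absorption binomial_absorb_comp mult.commute[of "m choose k"])
  ultimately have "Suc k * ((t choose Suc k) * n ^ Suc k) \<le> Suc k * ((n choose Suc k) * t ^ Suc k)"
    by (simp only: mult.assoc[symmetric] c power_Suc2) (simp add: ac_simps)
  then show ?case by (subst (asm) Suc_mult_le_cancel1)
qed simp

text \<open>In the sum of \<open>card_ball_containing\<close>, each \<open>i choose card A\<close>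
  is at most \<open>t choose card A\<close>; what remains is the volume, and
  \<open>binomial_ratio\<close> handles the quotient of binomials.\<close>

lemma card_ball_containing_le:
  assumes x: "x \<in> words q n" and A: "A \<subseteq> {..<n}" and "t \<le> n" "n \<ge> 1"
  shows "card {z \<in> words q n. A \<subseteq> diff_coords x z \<and> hamming_dist x z \<le> t}
       \<le> (t / n) ^ card A * hamming_ball_vol q n t"
proof -
  let ?c = "card {z \<in> words q n. A \<subseteq> diff_coords x z \<and> hamming_dist x z \<le> t}"
  let ?k = "card A"
  have "?k \<le> n" using card_mono[OF _ A] by simp
  then have pos: "n choose ?k > 0" by simp
  have "?c * (n choose ?k) \<le> (t choose ?k) * hamming_ball_vol q n t"
    unfolding card_ball_containing[OF x A] hamming_ball_vol_def sum_distrib_left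
    by (intro sum_mono) (auto intro!: mult_right_mono binomial_mono simp: binomial_right_mono)
  then have "(?c * (n choose ?k)) * n ^ ?k \<le> ((t choose ?k) * n ^ ?k) * hamming_ball_vol q n t"
    by (simp add: ac_simps mult_left_mono)
  also have "\<dots> \<le> ((n choose ?k) * t ^ ?k) * hamming_ball_vol q n t"
    by (intro mult_right_mono binomial_ratio assms) auto
  finally have "(n choose ?k) * (?c * n ^ ?k) \<le> (n choose ?k) * (t ^ ?k * hamming_ball_vol q n t)"
    by (simp add: ac_simps)
  then have "?c * n ^ ?k \<le> t ^ ?k * hamming_ball_vol q n t" using pos by simp
  then have "real (?c * n ^ ?k) \<le> real (t ^ ?k * hamming_ball_vol q n t)"
    by (rule of_nat_mono)
  then show ?thesis using assms by (simp add: field_simps power_divide)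
qed

section \<open>Overlaps of pairs of balls\<close>

definition ball_overlap :: "nat \<Rightarrow> nat \<Rightarrow> nat \<Rightarrow> nat list \<Rightarrow> nat list \<Rightarrow> nat" where
  "ball_overlap q n t x y = card {z \<in> words q n. hamming_dist x z \<le> t \<and> hamming_dist y z \<le> t}"

lemma ball_overlap_le_vol:
  "x \<in> words q n \<Longrightarrow> ball_overlap q n t x y \<le> hamming_ball_vol q n t"
  unfolding ball_overlap_def card_ball[of x, symmetric] by (intro card_mono) auto

lemma ball_overlap_far:
  assumes xy: "x \<in> words q n" "y \<in> words q n" and far: "hamming_dist x y > 2 * t"
  shows "ball_overlap q n t x y = 0"
proof -
  have "\<not> (hamming_dist x z \<le> t \<and> hamming_dist y z \<le> t)" if "z \<in> words q n" for z
  proof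
    assume *: "hamming_dist x z \<le> t \<and> hamming_dist y z \<le> t"
    have "diff_coords x y \<subseteq> diff_coords x z \<union> diff_coords y z" using xy that by (auto simp: diff_coords_def words_def)
    then have "card (diff_coords x y) \<le> card (diff_coords x z \<union> diff_coords y z)" by (intro card_mono) auto
    also have "\<dots> \<le> card (diff_coords x z) + card (diff_coords y z)" by (rule card_Un_le)
    finally show False using far * by (simp add: hamming_dist_eq)
  qed
  then show ?thesis unfolding ball_overlap_def by (simp add: card_eq_0_iff)
qed

text \<open>Pigeonhole: fix \<open>2 * k - 1\<close> coordinates where \<open>x\<close> and
  \<open>y\<close> disagree. A word \<open>z\<close> disagrees with \<open>x\<close> or with
  \<open>y\<close> at each of them, hence with one of the two on some \<open>k\<close> of them. The
  union bound over the \<open>k\<close>-subsets and the two centres gives the constant.\<close>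

lemma ball_overlap_le:
  assumes xy: "x \<in> words q n" "y \<in> words q n" and d: "hamming_dist x y \<ge> 2 * k - 1" "k \<ge> 1"
    and "t \<le> n" "n \<ge> 1"
  shows "ball_overlap q n t x y
      \<le> 2 * ((2 * k - 1) choose k) * (t / n) ^ k * hamming_ball_vol q n t"
proof -
  obtain D where D: "D \<subseteq> diff_coords x y" "card D = 2 * k - 1" "finite D"
    using obtain_subset_with_card_n[of "2 * k - 1" "diff_coords x y"] d unfolding hamming_dist_eq by blast
  let ?Z = "\<lambda>w A. {z \<in> words q n. A \<subseteq> diff_coords w z \<and> hamming_dist w z \<le> t}"
  let ?P = "{A. A \<subseteq> D \<and> card A = k}"
  have fP: "finite ?P" using D by (auto intro: finite_subset[of _ "Pow D"])
  have Dn: "D \<subseteq> {..<n}" using D diff_coords_subset[OF xy(1)] by blast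
  have sub: "{z \<in> words q n. hamming_dist x z \<le> t \<and> hamming_dist y z \<le> t}
      \<subseteq> (\<Union>A\<in>?P. ?Z x A \<union> ?Z y A)"
  proof safe
    fix z assume z: "z \<in> words q n" "hamming_dist x z \<le> t" "hamming_dist y z \<le> t"
    have "D \<subseteq> (D \<inter> diff_coords x z) \<union> (D \<inter> diff_coords y z)"
      using D xy z by (auto simp: diff_coords_def words_def)
    then have "card D \<le> card ((D \<inter> diff_coords x z) \<union> (D \<inter> diff_coords y z))"
      using D by (intro card_mono) auto
    also have "\<dots> \<le> card (D \<inter> diff_coords x z) + card (D \<inter> diff_coords y z)" by (rule card_Un_le)
    finally have "k \<le> card (D \<inter> diff_coords x z) \<or> k \<le> card (D \<inter> diff_coords y z)" using D d by linarith
    then obtain A where "card A = k" "A \<subseteq> D \<inter> diff_coords x z \<or> A \<subseteq> D \<inter> diff_coords y z"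
      by (metis obtain_subset_with_card_n)
    then show "z \<in> (\<Union>A\<in>?P. ?Z x A \<union> ?Z y A)" using z by auto
  qed
  have "ball_overlap q n t x y \<le> card (\<Union>A\<in>?P. ?Z x A \<union> ?Z y A)"
    unfolding ball_overlap_def using sub fP by (intro card_mono) auto
  also have "\<dots> \<le> (\<Sum>A\<in>?P. card (?Z x A \<union> ?Z y A))" using fP by (rule card_UN_le)
  also have "\<dots> \<le> (\<Sum>A\<in>?P. card (?Z x A) + card (?Z y A))"
    by (intro sum_mono card_Un_le)
  finally have "real (ball_overlap q n t x y) \<le> (\<Sum>A\<in>?P. real (card (?Z x A)) + card (?Z y A))"
    by (metis (mono_tags, lifting) of_nat_add of_nat_le_iff of_nat_sum sum.cong)
  also have "\<dots> \<le> (\<Sum>A\<in>?P. 2 * (t / n) ^ k * hamming_ball_vol q n t)"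
  proof (intro sum_mono)
    fix A assume A: "A \<in> ?P"
    have "A \<subseteq> {..<n}" using A Dn by auto
    from card_ball_containing_le[OF xy(1) this assms(5,6)] card_ball_containing_le[OF xy(2) this assms(5,6)]
    show "real (card (?Z x A)) + card (?Z y A) \<le> 2 * (t / n) ^ k * hamming_ball_vol q n t"
      using A by simp
  qed
  also have "\<dots> = card ?P * (2 * (t / n) ^ k * hamming_ball_vol q n t)" by simp
  also have "card ?P = (2 * k - 1) choose k" using D by (simp add: n_subsets)
  finally show ?thesis by (simp add: ac_simps)
qed

text \<open>For \<open>i \<le> t\<close>, replacing \<open>n choose i\<close> by
  \<open>(t choose i) * n ^ i\<close> turns the volume into a binomial expansion.\<close>

lemma hamming_ball_vol_le_pow:
  assumes "n \<ge> 1"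
  shows "hamming_ball_vol q n t \<le> (n * (q - 1) + 1) ^ t"
proof -
  have "hamming_ball_vol q n t \<le> (\<Sum>i=0..t. (t choose i) * (n * (q - 1)) ^ i)"
    unfolding hamming_ball_vol_def
  proof (intro sum_mono)
    fix i assume "i \<in> {0..t}"
    then have "1 * n ^ i \<le> (t choose i) * n ^ i" by (intro mult_right_mono) (auto simp: Suc_le_eq)
    moreover have "n choose i \<le> n ^ i"
      by (cases "i \<le> n") (auto intro: binomial_le_pow simp: not_le binomial_eq_0)
    ultimately have "n choose i \<le> (t choose i) * n ^ i" by linarith
    then show "(n choose i) * (q - 1) ^ i \<le> (t choose i) * (n * (q - 1)) ^ i"
      by (simp add: power_mult_distrib flip: mult.assoc)
  qed
  also have "\<dots> = (n * (q - 1) + 1) ^ t"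
    by (subst binomial_ring) (simp add: atLeast0AtMost)
  finally show ?thesis .
qed

lemma hamming_ball_vol_pos: "hamming_ball_vol q n t > 0"
proof -
  have "(\<Sum>i\<in>{0}. (n choose i) * (q - 1) ^ i) \<le> hamming_ball_vol q n t"
    unfolding hamming_ball_vol_def by (intro sum_mono2) auto
  then show ?thesis by simp
qed

text \<open>
  With \<open>a z\<close> the number of members of \<open>U\<close> within distance \<open>t\<close> of \<open>z\<close>, this compares
  \<open>\<Sum>z. (a z)\<^sup>2\<close>, which counts overlaps, with its lower bound coming from the mean \<open>\<mu>\<close> of \<open>a\<close>.
\<close>

lemma exists_large_overlap:
  assumes U: "U \<subseteq> words q n" "U \<noteq> {}" and q: "q \<ge> 1"
  shows "\<exists>x\<in>U. (\<Sum>y\<in>U - {x}. real (ball_overlap q n t x y))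
      \<ge> hamming_ball_vol q n t * (card U / hamming_bound q n t - 1)"
proof (rule ccontr)
  define V where "V = real (hamming_ball_vol q n t)"
  define N where "N = real (q ^ n)"
  define \<mu> where "\<mu> = card U * V / N"
  have V: "V > 0" using hamming_ball_vol_pos by (simp add: V_def)
  have N: "N > 0" using q by (simp add: N_def)
  have fU: "finite U" using U finite_subset[OF _ finite_words] by blast
  let ?I = "\<lambda>x y z. of_bool (hamming_dist x z \<le> t \<and> hamming_dist y z \<le> t) :: real"
  let ?a = "\<lambda>z. \<Sum>x\<in>U. of_bool (hamming_dist x z \<le> t) :: real"
  have ov: "real (ball_overlap q n t x y) = (\<Sum>z\<in>words q n. ?I x y z)" for x y
    by (simp add: ball_overlap_def Int_def)
  have self: "real (ball_overlap q n t x x) = V" if "x \<in> U" for x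
    using that U card_ball[of x q n t] by (auto simp: ball_overlap_def V_def)
  have "(\<Sum>z\<in>words q n. ?a z) = (\<Sum>x\<in>U. \<Sum>z\<in>words q n. of_bool (hamming_dist x z \<le> t))"
    by (rule sum.swap)
  also have "\<dots> = (\<Sum>x\<in>U. V)"
    using self by (intro sum.cong refl) (simp add: ov)
  finally have suma: "(\<Sum>z\<in>words q n. ?a z) = card U * V" by simp
  have "(\<Sum>z\<in>words q n. (?a z)\<^sup>2) = (\<Sum>z\<in>words q n. \<Sum>x\<in>U. \<Sum>y\<in>U. ?I x y z)"
    by (simp add: power2_eq_square sum_product of_bool_conj)
  also have "\<dots> = (\<Sum>x\<in>U. \<Sum>z\<in>words q n. \<Sum>y\<in>U. ?I x y z)" by (rule sum.swap)
  also have "\<dots> = (\<Sum>x\<in>U. \<Sum>y\<in>U. \<Sum>z\<in>words q n. ?I x y z)"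
    by (intro sum.cong refl sum.swap)
  \<comment> \<open>The diagonal pair \<open>y = x\<close> contributes a full ball and is split
    off.\<close>
  also have "\<dots> = (\<Sum>x\<in>U. V + (\<Sum>y\<in>U - {x}. real (ball_overlap q n t x y)))"
    using fU self by (intro sum.cong refl) (simp add: sum.remove flip: ov)
  finally have sq: "(\<Sum>z\<in>words q n. (?a z)\<^sup>2)
      = (\<Sum>x\<in>U. V + (\<Sum>y\<in>U - {x}. real (ball_overlap q n t x y)))" .
  \<comment> \<open>Cauchy--Schwarz in the form of a nonnegative variance; the last two terms of the
    expansion combine because \<open>N * \<mu> = card U * V\<close>.\<close>
  have "0 \<le> (\<Sum>z\<in>words q n. (?a z - \<mu>)\<^sup>2)" by (intro sum_nonneg) auto
  also have "\<dots> = (\<Sum>z\<in>words q n. (?a z)\<^sup>2) - 2 * \<mu> * (\<Sum>z\<in>words q n. ?a z) + N * \<mu>\<^sup>2"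
    by (simp add: power2_diff sum.distrib sum_subtractf card_words N_def sum_distrib_left
        sum_distrib_right ac_simps)
  also have "\<dots> = (\<Sum>z\<in>words q n. (?a z)\<^sup>2) - card U * V * \<mu>"
    unfolding suma using N by (simp add: \<mu>_def power2_eq_square)
  finally have low: "card U * V * \<mu> \<le> (\<Sum>z\<in>words q n. (?a z)\<^sup>2)" by simp
  assume "\<not> ?thesis"
  then have lt: "(\<Sum>y\<in>U - {x}. real (ball_overlap q n t x y)) < V * (\<mu> - 1)" if "x \<in> U" for x
    using that by (force simp: V_def \<mu>_def N_def hamming_bound_def not_le)
  have "(\<Sum>z\<in>words q n. (?a z)\<^sup>2) < (\<Sum>x\<in>U. V + V * (\<mu> - 1))"
    unfolding sq using U fU lt by (intro sum_strict_mono) auto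
  also have "\<dots> = card U * V * \<mu>" by (simp add: algebra_simps)
  finally show False using low by simp
qed

section \<open>Degrees in the conflict graph\<close>

abbreviation conflict :: "nat \<Rightarrow> nat list \<Rightarrow> nat list \<Rightarrow> bool" where
  "conflict t x y \<equiv> hamming_dist x y \<le> 2 * t"

lemma codes_eq_indep_sets: "{C. is_code q n t C} = indep_sets (conflict t) (words q n)"
  by (auto simp: is_code_def indep_sets_def not_le Suc_le_eq)

lemma hamming_bound_pos: "q \<ge> 1 \<Longrightarrow> hamming_bound q n t > 0"
  using hamming_ball_vol_pos by (simp add: hamming_bound_def)

text \<open>Take the \<open>x\<close> of \<open>exists_large_overlap\<close> and split its total
  overlap: words within distance \<open>r\<close> contribute at most a full ball each, the other
  conflicting words at most a fraction \<open>c\<close> of a ball, and all remaining words nothing.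
  Excluding \<open>x\<close> itself leaves at most \<open>hamming_ball_vol q n r - 1\<close> near
  words, whose \<open>- 1\<close> cancels the one in the overlap bound.\<close>

lemma exists_large_degree:
  fixes c :: real
  assumes W: "W \<subseteq> words q n" "W \<noteq> {}" and q: "q \<ge> 1" and c: "c \<ge> 0"
    and far: "\<And>x y. x \<in> words q n \<Longrightarrow> y \<in> words q n \<Longrightarrow> hamming_dist x y > r \<Longrightarrow>
                ball_overlap q n t x y \<le> c * hamming_ball_vol q n t"
  shows "\<exists>x\<in>W. card W / hamming_bound q n t - hamming_ball_vol q n r
           \<le> c * card {y \<in> W. y \<noteq> x \<and> conflict t x y}"
proof -
  let ?V = "real (hamming_ball_vol q n t)"
  have fW: "finite W" using W finite_subset[OF _ finite_words] by blast
  obtain x where x: "x \<in> W" and big: "?V * (card W / hamming_bound q n t - 1)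
      \<le> (\<Sum>y\<in>W - {x}. real (ball_overlap q n t x y))"
    using exists_large_overlap[OF W q, of t] by blast
  have xw: "x \<in> words q n" using x W by blast
  let ?near = "{y \<in> W - {x}. hamming_dist x y \<le> r}"
  let ?D = "{y \<in> W. y \<noteq> x \<and> conflict t x y}"
  have "hamming_dist x x = 0" by (simp add: hamming_dist_def)
  then have "card ?near \<le> card ({z \<in> words q n. hamming_dist x z \<le> r} - {x})"
    using W by (intro card_mono) auto
  also have "\<dots> = hamming_ball_vol q n r - 1"
    using xw \<open>hamming_dist x x = 0\<close> by (simp add: card_Diff_singleton card_ball)
  finally have near: "real (card ?near) \<le> real (hamming_ball_vol q n r) - 1"
    using hamming_ball_vol_pos[of q n r] by linarith
  have "ball_overlap q n t x y \<le> ?V * of_bool (hamming_dist x y \<le> r) + c * ?V * of_bool (conflict t x y)"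
    if "y \<in> W - {x}" for y
  proof -
    have yw: "y \<in> words q n" using that W by blast
    show ?thesis
      using ball_overlap_far[OF xw yw, of t] ball_overlap_le_vol[OF xw, of t y] far[OF xw yw] c
      by (cases "hamming_dist x y \<le> r"; cases "conflict t x y") (auto intro: add_increasing2)
  qed
  then have "(\<Sum>y\<in>W - {x}. real (ball_overlap q n t x y))
      \<le> (\<Sum>y\<in>W - {x}. ?V * of_bool (hamming_dist x y \<le> r) + c * ?V * of_bool (conflict t x y))"
    by (rule sum_mono)
  also have "\<dots> = ?V * card ?near + c * ?V * card ((W - {x}) \<inter> {y. conflict t x y})"
    using fW by (simp add: sum.distrib Int_def flip: sum_distrib_left)
  also have "(W - {x}) \<inter> {y. conflict t x y} = ?D" by auto
  also have "?V * card ?near + c * ?V * card ?D \<le> ?V * (real (hamming_ball_vol q n r) - 1) + c * ?V * card ?D"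
    using near by (intro add_mono mult_left_mono order_refl) auto
  finally have "?V * (card W / hamming_bound q n t - 1)
      \<le> ?V * (real (hamming_ball_vol q n r) - 1 + c * card ?D)"
    using big by (simp add: algebra_simps)
  then have "card W / hamming_bound q n t - 1 \<le> real (hamming_ball_vol q n r) - 1 + c * card ?D"
    using hamming_ball_vol_pos[of q n t] by (subst (asm) mult_le_cancel_left_pos) auto
  then show ?thesis using x by (intro bexI[of _ x]) auto
qed

text \<open>The case \<open>k = 1\<close>, \<open>r = 0\<close>: the ball of radius 0 has volume 1,
  and any two distinct words have overlap at most \<open>2 * (t / n)\<close> of a ball.\<close>

lemma exists_large_degree_small:
  fixes \<delta> :: real
  assumes W: "W \<subseteq> words q n" and q: "q \<ge> 2" and t: "1 \<le> t" "t \<le> n" and \<delta>: "0 < \<delta>" "\<delta> \<le> 1"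
    and big: "card W > (1 + \<delta>) * hamming_bound q n t"
  shows "\<exists>x\<in>W. \<delta> * n / (4 * real t * hamming_bound q n t) * card W
           \<le> card {y \<in> W. y \<noteq> x \<and> conflict t x y}"
proof -
  let ?H = "hamming_bound q n t"
  define lam where "lam = card W / ?H"
  have H: "?H > 0" using q by (intro hamming_bound_pos) simp
  have lam: "lam > 1 + \<delta>" using big H by (simp add: lam_def field_simps)
  have "W \<noteq> {}" using big H \<delta> by (auto simp: mult_less_0_iff)
  then obtain x where x: "x \<in> W"
    and deg: "lam - hamming_ball_vol q n 0 \<le> 2 * (t / n) * card {y \<in> W. y \<noteq> x \<and> conflict t x y}"
    using exists_large_degree[of W q n "2 * (t / n)" 0 t] W q t ball_overlap_le[of _ q n _ 1 t]
    unfolding lam_def by (auto simp: Suc_le_eq)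
  \<comment> \<open>The excess \<open>lam - 1\<close> is bounded below by a multiple of
    \<open>lam\<close>, so that the degree becomes proportional to \<open>card W\<close>.\<close>
  have "\<delta> * (1 - \<delta>) \<ge> 0" using \<delta> by (intro mult_nonneg_nonneg) auto
  then have "1 \<le> (1 + \<delta>) * (1 - \<delta> / 2)" by (simp add: field_simps)
  also have "\<dots> \<le> lam * (1 - \<delta> / 2)" using lam \<delta> by (intro mult_right_mono) auto
  finally have "\<delta> / 2 * lam \<le> lam - 1" by (simp add: algebra_simps)
  then have "\<delta> / 2 * lam \<le> 2 * (t / n) * card {y \<in> W. y \<noteq> x \<and> conflict t x y}"
    using deg by (simp add: hamming_ball_vol_def)
  then have "\<delta> * n / (4 * real t * ?H) * card W \<le> card {y \<in> W. y \<noteq> x \<and> conflict t x y}"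
    using t H by (simp add: lam_def field_simps)
  then show ?thesis using x by blast
qed

text \<open>The case \<open>k = 3\<close>, \<open>r = 4\<close>, with
  \<open>20 = 2 * (5 choose 3)\<close>. The ball of radius 4 has at most \<open>(n * q) ^ 4\<close>
  words, which is at most half of \<open>lam\<close>; losing this half turns 20 into 40.\<close>

lemma exists_large_degree_big:
  assumes W: "W \<subseteq> words q n" and q: "q \<ge> 2" and t: "1 \<le> t" "t \<le> n"
    and big: "card W > real (n * q) ^ 6 * hamming_bound q n t"
  shows "\<exists>x\<in>W. real n ^ 3 / (40 * real t ^ 3 * hamming_bound q n t) * card W
           \<le> card {y \<in> W. y \<noteq> x \<and> conflict t x y}"
proof -
  let ?H = "hamming_bound q n t"
  define lam where "lam = card W / ?H"
  have H: "?H > 0" using q by (intro hamming_bound_pos) simp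
  have lam: "lam > real (n * q) ^ 6" using big H by (simp add: lam_def field_simps)
  have five: "(5 choose 3) = (10::nat)" by (simp add: eval_nat_numeral)
  have "ball_overlap q n t x y \<le> 20 * (t / n) ^ 3 * hamming_ball_vol q n t"
    if "x \<in> words q n" "y \<in> words q n" "hamming_dist x y > 4" for x y
    using ball_overlap_le[of x q n y 3 t] that t by (simp add: five)
  moreover have "W \<noteq> {}" using big H by (auto simp: mult_less_0_iff)
  ultimately obtain x where x: "x \<in> W"
    and deg: "lam - hamming_ball_vol q n 4 \<le> 20 * (t / n) ^ 3 * card {y \<in> W. y \<noteq> x \<and> conflict t x y}"
    using exists_large_degree[of W q n "20 * (t / n) ^ 3" 4 t] W q
    unfolding lam_def by auto
  have nq: "2 \<le> n * q" using q t mult_le_mono[of 1 n 2 q] by simp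
  have "n * (q - 1) + 1 \<le> n * q" using q t by (cases q) auto
  then have "(n * (q - 1) + 1) ^ 4 \<le> (n * q) ^ 4" by (rule power_mono) simp
  then have "hamming_ball_vol q n 4 \<le> (n * q) ^ 4"
    using hamming_ball_vol_le_pow[of n q 4] t by linarith
  then have "2 * hamming_ball_vol q n 4 \<le> 2 ^ 2 * (n * q) ^ 4" by simp
  also have "\<dots> \<le> (n * q) ^ 2 * (n * q) ^ 4" using nq by (intro mult_right_mono power_mono) auto
  also have "\<dots> = (n * q) ^ 6" by (simp flip: power_add)
  finally have "2 * real (hamming_ball_vol q n 4) \<le> real (n * q) ^ 6"
    by (metis of_nat_le_iff of_nat_mult of_nat_numeral of_nat_power)
  then have "lam / 2 \<le> 20 * (t / n) ^ 3 * card {y \<in> W. y \<noteq> x \<and> conflict t x y}"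
    using deg lam by linarith
  then have "real n ^ 3 / (40 * real t ^ 3 * ?H) * card W \<le> card {y \<in> W. y \<noteq> x \<and> conflict t x y}"
    using t H by (simp add: lam_def field_simps)
  then show ?thesis using x by blast
qed

section \<open>Counting codes in two stages and estimating the exponent\<close>

lemma card_codes_le:
  fixes \<delta> :: real
  assumes q: "q \<ge> 2" and t: "1 \<le> t" "t \<le> n" and \<delta>: "0 < \<delta>" "\<delta> \<le> 1"
  defines "H \<equiv> hamming_bound q n t" and "V \<equiv> real (hamming_ball_vol q n t)"
    and "\<Lambda> \<equiv> real (n * q) ^ 6"
  shows "card {C. is_code q n t C} \<le> 2 powr ((1 + \<delta>) * H)
      * exp (H / n + (4 * real t * H / (\<delta> * n) * ln \<Lambda> + 1) * ln (n * \<Lambda>))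
      * exp (H / n + (40 * real t ^ 3 * H / real n ^ 3 * ln V + 1) * ln (n * V))"
proof -
  have H: "H > 0" using q unfolding H_def by (intro hamming_bound_pos) simp
  have V: "V \<ge> 1" using hamming_ball_vol_pos[of q n t] by (simp add: V_def)
  have qn: "real (q ^ n) = V * H" using V by (simp add: H_def V_def hamming_bound_def)
  have "1 * 1 \<le> n * q" using q t by (intro mult_le_mono) auto
  then have \<Lambda>: "\<Lambda> \<ge> 1" unfolding \<Lambda>_def by (intro one_le_power) linarith
  have ge1: "1 \<le> real n * z" if "1 \<le> z" for z
    using mult_mono[of 1 "real n" 1 z] that t by simp
  have small: "card (indep_sets (conflict t) W) \<le> 2 powr ((1 + \<delta>) * H)"
    if W: "W \<subseteq> words q n" "card W \<le> (1 + \<delta>) * H" for W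
  proof -
    have "real (card (indep_sets (conflict t) W)) \<le> 2 powr card W"
      using card_indep_sets_le[of W "conflict t"] finite_subset[OF W(1)]
      by (simp add: powr_realpow)
    also have "\<dots> \<le> 2 powr ((1 + \<delta>) * H)" using W by simp
    finally show ?thesis .
  qed
  have medium: "card (indep_sets (conflict t) W) \<le> 2 powr ((1 + \<delta>) * H)
      * exp (H / n + (4 * real t * H / (\<delta> * n) * ln \<Lambda> + 1) * ln (n * \<Lambda>))"
    if W: "W \<subseteq> words q n" "card W \<le> \<Lambda> * H" for W
  proof -
    have "card (indep_sets (conflict t) W) \<le> 2 powr ((1 + \<delta>) * H)
      * exp (\<Lambda> * H / (n * \<Lambda>) + (4 * real t * H / (\<delta> * n) * ln \<Lambda> + 1) * ln (n * \<Lambda>))"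
    \<comment> \<open>\<open>L\<close> is chosen as \<open>ln \<Lambda> / \<beta>\<close>, so that
      \<open>\<Lambda> * H\<close> shrinks to \<open>H\<close>; the base case \<open>M\<close> is
      \<open>small\<close>.\<close>
    proof (rule card_indep_sets_container_exp[where R = "(1 + \<delta>) * H" and \<beta> = "\<delta> * n / (4 * real t * H)"])
      have "- (\<delta> * n / (4 * real t * H)) * (4 * real t * H / (\<delta> * n) * ln \<Lambda>) = - ln \<Lambda>"
        using t \<delta> H by (simp add: field_simps)
      then show "\<Lambda> * H * exp (- (\<delta> * n / (4 * real t * H)) * (4 * real t * H / (\<delta> * n) * ln \<Lambda>)) \<le> (1 + \<delta>) * H"
        using \<Lambda> H \<delta> by (simp add: exp_minus)
    qed (use W t \<delta> H \<Lambda> ge1 q small exists_large_degree_small[of _ q n t \<delta>] finite_subset[OF W(1)]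
         in \<open>auto simp: H_def\<close>)
    also have "\<Lambda> * H / (n * \<Lambda>) = H / n" using \<Lambda> by simp
    finally show ?thesis .
  qed
  have "card (indep_sets (conflict t) (words q n)) \<le> 2 powr ((1 + \<delta>) * H)
      * exp (H / n + (4 * real t * H / (\<delta> * n) * ln \<Lambda> + 1) * ln (n * \<Lambda>))
      * exp (V * H / (n * V) + (40 * real t ^ 3 * H / real n ^ 3 * ln V + 1) * ln (n * V))"
  \<comment> \<open>The outer stage starts from all \<open>q ^ n = V * H\<close> words, takes
    \<open>L = ln V / \<beta>\<close> and uses \<open>medium\<close> as its base case.\<close>
  proof (rule card_indep_sets_container_exp[where R = "\<Lambda> * H" and \<beta> = "real n ^ 3 / (40 * real t ^ 3 * H)"])
    have "- (real n ^ 3 / (40 * real t ^ 3 * H)) * (40 * real t ^ 3 * H / real n ^ 3 * ln V) = - ln V"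
      using t H by (simp add: field_simps)
    then show "V * H * exp (- (real n ^ 3 / (40 * real t ^ 3 * H)) * (40 * real t ^ 3 * H / real n ^ 3 * ln V))
        \<le> \<Lambda> * H"
      using \<Lambda> H V by (simp add: exp_minus)
    show "real (card (words q n)) \<le> V * H" by (simp add: card_words qn[symmetric])
    show "1 \<le> real n * V" using V by (rule ge1)
    show "\<exists>v\<in>W. real n ^ 3 / (40 * real t ^ 3 * H) * card W \<le> card {y \<in> W. y \<noteq> v \<and> conflict t v y}"
      if "W \<subseteq> words q n" "card W > \<Lambda> * H" for W
      using exists_large_degree_big[of W q n t] that q t unfolding H_def \<Lambda>_def by blast
  qed (use t H V medium in auto)
  also have "V * H / (n * V) = H / n" using V by simp
  finally show ?thesis unfolding codes_eq_indep_sets .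
qed

text \<open>The relative loss in the exponent, with \<open>10 * sqrt n\<close> standing for
  \<open>t\<close>: first \<open>\<delta>\<close>, then over \<open>ln 2\<close> (to pass to base 2)
  the two terms \<open>H / n\<close>, the cost of the inner stage, the cost of the outer stage, and
  the additive leftovers. Up to squared logarithms the two stages cost
  \<open>n powr (- 1 / 4)\<close> and \<open>n powr (- 1 / 2)\<close>.\<close>

definition code_exponent_error :: "nat \<Rightarrow> nat \<Rightarrow> real" where
  "code_exponent_error q n =
    real n powr (- 1 / 4)
    + (2 / n
       + 168 * (10 * sqrt n) * (ln n + ln q)\<^sup>2 / (real n powr (- 1 / 4) * n)
       + 80 * (10 * sqrt n) ^ 5 * (ln n + ln q)\<^sup>2 / real n ^ 3
       + (20 * sqrt n + 7) * (ln n + ln q) * exp (10 * sqrt n * (ln n + ln q) - n * ln 2)) / ln 2"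

lemma code_exponent_error_tendsto: "code_exponent_error q \<longlonglongrightarrow> 0"
  unfolding code_exponent_error_def by real_asymp

lemma card_codes_le_powr:
  assumes q: "q \<ge> 2" and t: "1 \<le> t" "t \<le> n" "t \<le> 10 * sqrt n"
  shows "card {C. is_code q n t C} \<le> 2 powr ((1 + code_exponent_error q n) * hamming_bound q n t)"
proof -
  define H where "H = hamming_bound q n t"
  define V where "V = real (hamming_ball_vol q n t)"
  define \<Lambda> where "\<Lambda> = real (n * q) ^ 6"
  define \<delta> where "\<delta> = real n powr (- 1 / 4)"
  define T where "T = 10 * sqrt n"
  define m where "m = ln n + ln q"
  have n: "n \<ge> 1" using t by simp
  have \<delta>: "0 < \<delta>" "\<delta> \<le> 1" using n by (auto simp: \<delta>_def powr_le1 powr_minus field_simps ge_one_powr_ge_zero)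
  have tT: "real t \<le> T" using t by (simp add: T_def)
  have H: "H > 0" using q unfolding H_def by (intro hamming_bound_pos) simp
  have V: "V \<ge> 1" using hamming_ball_vol_pos[of q n t] by (simp add: V_def)
  have qn: "real (q ^ n) = V * H" using V by (simp add: H_def V_def hamming_bound_def)
  have m: "m = ln (real (n * q))" using n q by (simp add: m_def ln_mult)
  have lnn: "0 \<le> ln (real n)" "ln (real n) \<le> m" using n q by (auto simp: m_def)
  have m0: "m \<ge> 0" using lnn by simp
  have "n * (q - 1) + 1 \<le> n * q" using q n by (cases q) auto
  then have "(n * (q - 1) + 1) ^ t \<le> (n * q) ^ t" by (rule power_mono) simp
  then have "hamming_ball_vol q n t \<le> (n * q) ^ t"
    using hamming_ball_vol_le_pow[OF n, of q t] by (rule order_trans[rotated])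
  then have "V \<le> real (n * q) ^ t" unfolding V_def by (metis of_nat_le_iff of_nat_power)
  then have "ln V \<le> ln (real (n * q) ^ t)" using V by (intro ln_mono) auto
  then have lnV: "ln V \<le> t * m" using n q by (simp add: m ln_realpow)
  have nV: "1 \<le> real n * V" using mult_mono[of 1 "real n" 1 V] V n by simp
  have lnV0: "0 \<le> ln V" using V by simp
  have "real t \<ge> 1" using t by simp
  then have "m \<le> t * m" using m0 mult_right_mono[of 1 "real t" m] by simp
  then have lnnV: "ln (n * V) \<le> 2 * t * m" using V n lnV lnn by (simp add: ln_mult)
  have ln\<Lambda>: "ln \<Lambda> = 6 * m" using n q by (simp add: \<Lambda>_def m ln_realpow)
  have "\<Lambda> > 0" using n q by (simp add: \<Lambda>_def)
  then have lnn\<Lambda>: "ln (n * \<Lambda>) \<le> 7 * m" using n lnn ln\<Lambda> by (simp add: ln_mult)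
  \<comment> \<open>\<open>H\<close> is exponentially large, since \<open>q ^ n = V * H\<close> and
    \<open>V \<le> (n * q) ^ t\<close>. This lets \<open>H\<close> absorb the terms that do not
    carry it as a factor.\<close>
  have "n * ln 2 \<le> n * ln q" using q by (intro mult_left_mono ln_mono) auto
  also have "\<dots> = ln (V * H)" using q by (simp add: ln_realpow flip: qn)
  also have "\<dots> = ln V + ln H" using V H by (simp add: ln_mult)
  also have "\<dots> \<le> T * m + ln H" using lnV mult_right_mono[OF tT m0] by simp
  finally have "exp (- ln H) \<le> exp (T * m - n * ln 2)" by simp
  then have invH: "1 \<le> H * exp (T * m - n * ln 2)" using H by (simp add: exp_minus field_simps)
  \<comment> \<open>\<open>168 = 4 * 6 * 7\<close>, from \<open>ln \<Lambda> = 6 * m\<close> and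
    \<open>ln (n * \<Lambda>) \<le> 7 * m\<close>.\<close>
  have A: "(4 * real t * H / (\<delta> * n) * ln \<Lambda> + 1) * ln (n * \<Lambda>)
      \<le> H * (168 * T * m\<^sup>2 / (\<delta> * n)) + 7 * m"
  proof -
    have "(4 * real t * H / (\<delta> * n) * ln \<Lambda> + 1) * ln (n * \<Lambda>)
        \<le> (4 * T * H / (\<delta> * n) * (6 * m) + 1) * (7 * m)"
      unfolding ln\<Lambda> using lnn\<Lambda> H \<delta> m0 tT
      by (intro mult_mono add_mono divide_right_mono add_nonneg_nonneg mult_nonneg_nonneg divide_nonneg_nonneg)
         (auto intro: order_trans[OF _ tT] simp: ln_mult ln\<Lambda> n)
    then show ?thesis by (simp add: power2_eq_square algebra_simps)
  qed
  \<comment> \<open>The fifth power is \<open>t ^ 3\<close> from the degree bound and one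
    \<open>t\<close> from each of \<open>ln V\<close> and \<open>ln (n * V)\<close>.\<close>
  have B: "(40 * real t ^ 3 * H / real n ^ 3 * ln V + 1) * ln (n * V)
      \<le> H * (80 * T ^ 5 * m\<^sup>2 / real n ^ 3) + 2 * T * m"
  proof -
    have "(40 * real t ^ 3 * H / real n ^ 3 * ln V + 1) * ln (n * V)
        \<le> (40 * real t ^ 3 * H / real n ^ 3 * (t * m) + 1) * (2 * t * m)"
      using lnnV H m0 lnV lnV0 ln_ge_zero[OF nV]
      by (intro mult_mono add_mono mult_left_mono) auto
    also have "\<dots> = H * (80 * real t ^ 5 * m\<^sup>2 / real n ^ 3) + 2 * t * m"
      by (simp add: power2_eq_square algebra_simps eval_nat_numeral)
    also have "\<dots> \<le> H * (80 * T ^ 5 * m\<^sup>2 / real n ^ 3) + 2 * T * m"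
      using H m0 tT by (intro mult_mono add_mono divide_right_mono power_mono) auto
    finally show ?thesis .
  qed
  \<comment> \<open>The leftovers \<open>7 * m\<close> and \<open>2 * T * m\<close> come from
    rounding \<open>L\<close> up in the two stages.\<close>
  have "(2 * T + 7) * m \<le> (2 * T + 7) * m * (H * exp (T * m - n * ln 2))"
    using mult_left_mono[OF invH, of "(2 * T + 7) * m"] m0 by (simp add: T_def)
  then have "(1 + \<delta>) * H * ln 2
       + (H / n + (4 * real t * H / (\<delta> * n) * ln \<Lambda> + 1) * ln (n * \<Lambda>))
       + (H / n + (40 * real t ^ 3 * H / real n ^ 3 * ln V + 1) * ln (n * V))
      \<le> (1 + \<delta>) * H * ln 2 + H * (2 / n + 168 * T * m\<^sup>2 / (\<delta> * n) + 80 * T ^ 5 * m\<^sup>2 / real n ^ 3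
          + (2 * T + 7) * m * exp (T * m - n * ln 2))"
    using A B by (simp add: algebra_simps)
  also have "\<dots> = (1 + code_exponent_error q n) * H * ln 2"
    by (simp add: code_exponent_error_def \<delta>_def T_def m_def field_simps)
  finally have "(1 + \<delta>) * H * ln 2
       + (H / n + (4 * real t * H / (\<delta> * n) * ln \<Lambda> + 1) * ln (n * \<Lambda>))
       + (H / n + (40 * real t ^ 3 * H / real n ^ 3 * ln V + 1) * ln (n * V))
      \<le> (1 + code_exponent_error q n) * H * ln 2" .
  moreover have "2 powr ((1 + \<delta>) * H) = exp ((1 + \<delta>) * H * ln 2)" by (simp add: powr_def)
  then have "card {C. is_code q n t C} \<le> exp ((1 + \<delta>) * H * ln 2
       + (H / n + (4 * real t * H / (\<delta> * n) * ln \<Lambda> + 1) * ln (n * \<Lambda>))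
       + (H / n + (40 * real t ^ 3 * H / real n ^ 3 * ln V + 1) * ln (n * V)))"
    using card_codes_le[OF q t(1,2) \<delta>, folded H_def V_def \<Lambda>_def] by (simp only: exp_add)
  ultimately have "card {C. is_code q n t C} \<le> exp ((1 + code_exponent_error q n) * H * ln 2)"
    by (meson exp_le_cancel_iff order_trans)
  then show ?thesis by (simp add: powr_def H_def)
qed

theorem theorem1p1:
  fixes q :: nat and t :: "nat \<Rightarrow> nat"
  assumes "q \<ge> 2"
    and "\<And>n. n \<ge> 1 \<Longrightarrow> t n \<ge> 1 \<and> real (t n) \<le> 10 * sqrt (real n)"
  shows "\<exists>\<epsilon> :: nat \<Rightarrow> real. \<epsilon> \<longlonglongrightarrow> 0 \<and>
           (\<forall>n\<ge>1. real (card {C. is_code q n (t n) C})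
                    \<le> 2 powr ((1 + \<epsilon> n) * hamming_bound q n (t n)))"
proof -
  let ?c = "\<lambda>n. real (card {C. is_code q n (t n) C})"
  \<comment> \<open>From 100 on, \<open>10 * sqrt n \<le> n\<close> ensures
    \<open>t n \<le> n\<close>. For the finitely many smaller \<open>n\<close>, the value is chosen
    to make the exponent equal to the number of codes itself, and \<open>c \<le> 2 powr c\<close>
    suffices.\<close>
  define \<epsilon> where "\<epsilon> n = (if n \<ge> 100 then code_exponent_error q n
      else ?c n / hamming_bound q n (t n) - 1)" for n
  have "\<epsilon> \<longlonglongrightarrow> 0"
    using code_exponent_error_tendsto
    by (rule Lim_transform_eventually)
       (auto intro: eventually_mono[OF eventually_ge_at_top[of 100]] simp: \<epsilon>_def)
  moreover have "?c n \<le> 2 powr ((1 + \<epsilon> n) * hamming_bound q n (t n))" if n: "n \<ge> 1" for n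
  proof (cases "n \<ge> 100")
    case True
    have "10 * sqrt n \<le> sqrt n * sqrt n"
      using True by (intro mult_right_mono real_le_rsqrt) auto
    then have "real (t n) \<le> real n" using assms(2)[OF n] by simp
    then show ?thesis
      using card_codes_le_powr[of q "t n" n] assms(1) assms(2)[OF n] True by (simp add: \<epsilon>_def)
  next
    case False
    have "hamming_bound q n (t n) > 0" using assms(1) by (intro hamming_bound_pos) simp
    then have "(1 + \<epsilon> n) * hamming_bound q n (t n) = ?c n" using False by (simp add: \<epsilon>_def)
    moreover have "?c n \<le> 2 powr ?c n"
      using of_nat_less_two_power[of "card {C. is_code q n (t n) C}", where 'a = real]
      by (simp add: powr_realpow)
    ultimately show ?thesis by simp
  qed
  ultimately show ?thesis by blast
qed

end
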